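(* Let $(X,r)$ be a square-free solution of finite order $|X|=n$ and cyclic degree $p=p(X,r)$, and let $G=G(X,r)$ be the associated group. Fix an admissible enumeration $X=\{x_1<x_2<\cdots<x_n\}$ (as defined in the context), let $Y=\{x_1^{\alpha_1}\cdots x_n^{\alpha_n}\mid 0\le\alpha_i\le p-1,\ 1\le i\le n\}$, and let $\mathcal{F}_p$ be the subgroup of $G$ generated by $x_1^p,\dots,x_n^p$. Then: (1) Every element $u\in G$ has a unique presentation $u=yW$ with $y\in Y$ and $W\in\mathcal{F}_p$. (2) In particular, for every pair $y,z\in Y$ there exist uniquely determined $t\in Y$ and $W\in\mathcal{F}_p$ such that the equality $yz=tW$ holds in $G$. (3) $G$ splits as a union of $p^n$ disjoint subsets $$G=\bigcup_{y\in Y}y\mathcal{F}_p,\qquad (y\mathcal{F}_p)\cap(t\mathcal{F}_p)=\emptyset\quad\text{for all } y\ne t,\ y,t\in Y.$$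
   Context: Quadratic sets and solutions. Let $X$ be a nonempty set and $r:X\times X\to X\times X$ a bijection, written $r(x,y)=({}^xy,x^y)$. Put $\mathcal{L}_x(y)={}^xy$ and $\mathcal{R}_y(x)=x^y$. The map $r$ is nondegenerate if all $\mathcal{L}_x,\mathcal{R}_x$ are bijections of $X$; involutive if $r^2=\mathrm{id}$; $(X,r)$ is square-free if $r(x,x)=(x,x)$ for all $x\in X$; $r$ is a set-theoretic solution of the Yang–Baxter equation if $r^{12}r^{23}r^{12}=r^{23}r^{12}r^{23}$ on $X\times X\times X$, where $r^{12}=r\times\mathrm{id}_X$, $r^{23}=\mathrm{id}_X\times r$. Here "a solution" means a pair $(X,r)$ with $r$ nondegenerate, involutive and satisfying the Yang–Baxter equation. Associated objects. Let $\Re$ be the set of relations $xy=zt$ for all $x,y,z,t\in X$ with $r(x,y)=(z,t)$ and $(x,y)\ne(z,t)$. $S=S(X,r)$ is the monoid, $G=G(X,r)$ the group, and $A=A(\mathbf{k},X,r)$ the unital associative algebra over a field $\mathbf{k}$, generated by $X$ with defining relations $\Re$. For finite $(X,r)$ the canonical maps $X\to S\to G$ are injective, and $A$ is the monoid algebra $\mathbf{k}S$. Cyclic degree. For a finite solution, $p=p(X,r)$ is the least common multiple of the orders of the permutations $\mathcal{L}_x$, $x\in X$. Admissible enumeration. An enumeration $X=\{x_1<\dots<x_n\}$ of a finite square-free solution is called admissible if $A$ is, with respect to it, a binomial skew polynomial ring, that is: $\Re$ consists of exactly $\binom n2$ relations $x_jx_i=x_{i'}x_{j'}$, one for each pair $1\le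 i<j\le n$, with $j>i'$ and $i'<j'$; every monomial $x_ix_j$ with $i<j$ occurs as the right-hand side of some relation; and the set of ordered monomials $\mathcal{N}=\{x_1^{\alpha_1}\cdots x_n^{\alpha_n}\mid\alpha_i\ge0\}$ is a $\mathbf{k}$-basis of $A$ (equivalently, each element of $S$ is represented by a unique word in $\mathcal{N}$). It is a known theorem that an admissible enumeration always exists for a finite square-free solution. Elements of $\mathcal{N}$, in particular of $Y$, are regarded as elements of $S\subseteq G$. *)

theory Defs
  imports "HOL-Algebra.Bij" "HOL-Algebra.Multiplicative_Group" "HOL-Algebra.QuotRing"
    "HOL-Library.Poly_Mapping"
begin

section \<open>Set-theoretic solutions of the Yang--Baxter equation\<close>

text \<open>A quadratic set is a map \<open>r\<close> on pairs together with a carrier \<open>X\<close>; all conditions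
  are relative to \<open>X\<close>, and the values of \<open>r\<close> outside \<open>X \<times> X\<close> are irrelevant.\<close>

definition left_act :: "('a \<times> 'a \<Rightarrow> 'a \<times> 'a) \<Rightarrow> 'a \<Rightarrow> 'a \<Rightarrow> 'a" where
  "left_act r x y = fst (r (x, y))"

definition right_act :: "('a \<times> 'a \<Rightarrow> 'a \<times> 'a) \<Rightarrow> 'a \<Rightarrow> 'a \<Rightarrow> 'a" where
  "right_act r y x = snd (r (x, y))"

definition nondegenerate :: "'a set \<Rightarrow> ('a \<times> 'a \<Rightarrow> 'a \<times> 'a) \<Rightarrow> bool" where
  "nondegenerate X r \<longleftrightarrow>
     (\<forall>x\<in>X. bij_betw (left_act r x) X X \<and> bij_betw (right_act r x) X X)"

definition involutive :: "'a set \<Rightarrow> ('a \<times> 'a \<Rightarrow> 'a \<times> 'a) \<Rightarrow> bool" where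
  "involutive X r \<longleftrightarrow> (\<forall>u\<in>X \<times> X. r (r u) = u)"

definition square_free :: "'a set \<Rightarrow> ('a \<times> 'a \<Rightarrow> 'a \<times> 'a) \<Rightarrow> bool" where
  "square_free X r \<longleftrightarrow> (\<forall>x\<in>X. r (x, x) = (x, x))"

definition r12 :: "('a \<times> 'a \<Rightarrow> 'a \<times> 'a) \<Rightarrow> 'a \<times> 'a \<times> 'a \<Rightarrow> 'a \<times> 'a \<times> 'a" where
  "r12 r = (\<lambda>(x, y, z). (fst (r (x, y)), snd (r (x, y)), z))"

definition r23 :: "('a \<times> 'a \<Rightarrow> 'a \<times> 'a) \<Rightarrow> 'a \<times> 'a \<times> 'a \<Rightarrow> 'a \<times> 'a \<times> 'a" where
  "r23 r = (\<lambda>(x, y, z). (x, r (y, z)))"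

definition yang_baxter :: "'a set \<Rightarrow> ('a \<times> 'a \<Rightarrow> 'a \<times> 'a) \<Rightarrow> bool" where
  "yang_baxter X r \<longleftrightarrow>
     (\<forall>u\<in>X \<times> X \<times> X. r12 r (r23 r (r12 r u)) = r23 r (r12 r (r23 r u)))"

definition solution :: "'a set \<Rightarrow> ('a \<times> 'a \<Rightarrow> 'a \<times> 'a) \<Rightarrow> bool" where
  "solution X r \<longleftrightarrow> X \<noteq> {} \<and> bij_betw r (X \<times> X) (X \<times> X) \<and>
     nondegenerate X r \<and> involutive X r \<and> yang_baxter X r"

definition cyclic_degree :: "'a set \<Rightarrow> ('a \<times> 'a \<Rightarrow> 'a \<times> 'a) \<Rightarrow> nat" where
  "cyclic_degree X r =
     Lcm ((\<lambda>x. group.ord (BijGroup X) (restrict (left_act r x) X)) ` X)"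


section \<open>Words and presentations\<close>

text \<open>Words are lists of letters; a defining relation \<open>u = v\<close> is the pair \<open>(u, v)\<close>.\<close>

inductive word_cong :: "'b set \<Rightarrow> ('b list \<times> 'b list) set \<Rightarrow> 'b list \<Rightarrow> 'b list \<Rightarrow> bool"
  for B E where
  rel: "(u, v) \<in> E \<Longrightarrow> u \<in> lists B \<Longrightarrow> v \<in> lists B \<Longrightarrow> word_cong B E u v"
| refl: "u \<in> lists B \<Longrightarrow> word_cong B E u u"
| sym: "word_cong B E u v \<Longrightarrow> word_cong B E v u"
| trans: "word_cong B E u v \<Longrightarrow> word_cong B E v w \<Longrightarrow> word_cong B E u w"
| append: "word_cong B E u v \<Longrightarrow> word_cong B E u' v' \<Longrightarrow> word_cong B E (u @ u') (v @ v')"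

definition word_class :: "'b set \<Rightarrow> ('b list \<times> 'b list) set \<Rightarrow> 'b list \<Rightarrow> 'b list set" where
  "word_class B E w = {v. word_cong B E w v}"

definition presented_monoid :: "'b set \<Rightarrow> ('b list \<times> 'b list) set \<Rightarrow> 'b list set monoid" where
  "presented_monoid B E =
     \<lparr>carrier = word_class B E ` lists B,
      mult = (\<lambda>U V. \<Union>u\<in>U. \<Union>v\<in>V. word_class B E (u @ v)),
      one = word_class B E []\<rparr>"

text \<open>The group presented by \<open>X\<close> and \<open>E\<close>: the letter \<open>(x, True)\<close> stands for \<open>x\<close> and
  \<open>(x, False)\<close> for its formal inverse, with the cancellation relations added to \<open>E\<close>.\<close>

definition pos_word :: "'a list \<Rightarrow> ('a \<times> bool) list" where
  "pos_word w = map (\<lambda>x. (x, True)) w"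

definition group_rels ::
    "'a set \<Rightarrow> ('a list \<times> 'a list) set \<Rightarrow> (('a \<times> bool) list \<times> ('a \<times> bool) list) set" where
  "group_rels X E = {(pos_word u, pos_word v) | u v. (u, v) \<in> E} \<union>
     {([(x, b), (x, \<not> b)], []) | x b. x \<in> X}"

definition presented_group ::
    "'a set \<Rightarrow> ('a list \<times> 'a list) set \<Rightarrow> ('a \<times> bool) list set monoid" where
  "presented_group X E = presented_monoid (X \<times> UNIV) (group_rels X E)"


section \<open>The objects associated with a solution\<close>

text \<open>As \<open>r\<close> is involutive, every relation \<open>xy = zt\<close> occurs here in both orientations.\<close>

definition quad_rels :: "'a set \<Rightarrow> ('a \<times> 'a \<Rightarrow> 'a \<times> 'a) \<Rightarrow> ('a list \<times> 'a list) set" where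
  "quad_rels X r = {([x, y], [z, t]) | x y z t.
     x \<in> X \<and> y \<in> X \<and> z \<in> X \<and> t \<in> X \<and> r (x, y) = (z, t) \<and> (x, y) \<noteq> (z, t)}"

definition assoc_group ::
    "'a set \<Rightarrow> ('a \<times> 'a \<Rightarrow> 'a \<times> 'a) \<Rightarrow> ('a \<times> bool) list set monoid" where
  "assoc_group X r = presented_group X (quad_rels X r)"

text \<open>The image in \<open>G(X,r)\<close> of (the element of \<open>S(X,r)\<close> represented by) a word over \<open>X\<close>.\<close>

definition to_group ::
    "'a set \<Rightarrow> ('a \<times> 'a \<Rightarrow> 'a \<times> 'a) \<Rightarrow> 'a list \<Rightarrow> ('a \<times> bool) list set" where
  "to_group X r w = word_class (X \<times> UNIV) (group_rels X (quad_rels X r)) (pos_word w)"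

text \<open>The free monoid is written additively, so that the convolution product of finitely
  supported functions \<open>'a list \<Rightarrow>\<^sub>0 'k\<close> is the product of the free associative algebra.\<close>

instantiation list :: (type) monoid_add
begin
definition zero_list :: "'a list" where "zero_list = []"
definition plus_list :: "'a list \<Rightarrow> 'a list \<Rightarrow> 'a list" where "plus_list u v = u @ v"
instance by standard (simp_all add: zero_list_def plus_list_def)
end

definition free_algebra :: "'a set \<Rightarrow> ('a list \<Rightarrow>\<^sub>0 'k::field) ring" where
  "free_algebra X =
     \<lparr>carrier = {f. Poly_Mapping.keys f \<subseteq> lists X}, mult = (*), one = 1, zero = 0, add = (+)\<rparr>"

definition rel_ideal :: "'a set \<Rightarrow> ('a \<times> 'a \<Rightarrow> 'a \<times> 'a) \<Rightarrow> ('a list \<Rightarrow>\<^sub>0 'k::field) set" where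
  "rel_ideal X r = Idl\<^bsub>free_algebra X\<^esub>
     {Poly_Mapping.single u 1 - Poly_Mapping.single v 1 | u v. (u, v) \<in> quad_rels X r}"

definition assoc_algebra ::
    "'a set \<Rightarrow> ('a \<times> 'a \<Rightarrow> 'a \<times> 'a) \<Rightarrow> ('a list \<Rightarrow>\<^sub>0 'k::field) set ring" where
  "assoc_algebra X r = free_algebra X Quot rel_ideal X r"

definition to_algebra ::
    "'a set \<Rightarrow> ('a \<times> 'a \<Rightarrow> 'a \<times> 'a) \<Rightarrow> ('a list \<Rightarrow>\<^sub>0 'k::field) \<Rightarrow> ('a list \<Rightarrow>\<^sub>0 'k) set" where
  "to_algebra X r f = rel_ideal X r +>\<^bsub>free_algebra X\<^esub> f"

text \<open>A set \<open>N\<close> of words is a \<open>\<k>\<close>-basis of \<open>A(\<k>,X,r)\<close>. A finitely supported \<open>c\<close> with support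
  in \<open>N\<close> is the formal linear combination \<open>\<Sum>w\<in>N. c w \<cdot> w\<close>, so \<open>to_algebra X r c\<close> is the value of
  this combination in \<open>A(\<k>,X,r)\<close>. The two clauses are spanning and linear independence (of
  the family indexed by \<open>N\<close>, so distinct words have distinct images).\<close>

definition algebra_basis ::
    "'k::field itself \<Rightarrow> 'a set \<Rightarrow> ('a \<times> 'a \<Rightarrow> 'a \<times> 'a) \<Rightarrow> 'a list set \<Rightarrow> bool" where
  "algebra_basis K X r N \<longleftrightarrow> N \<subseteq> lists X \<and>
     (\<forall>a\<in>carrier (assoc_algebra X r :: ('a list \<Rightarrow>\<^sub>0 'k) set ring).
        \<exists>c. Poly_Mapping.keys c \<subseteq> N \<and> a = to_algebra X r c) \<and>
     (\<forall>c :: 'a list \<Rightarrow>\<^sub>0 'k. Poly_Mapping.keys c \<subseteq> N \<and>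
        to_algebra X r c = \<zero>\<^bsub>assoc_algebra X r\<^esub> \<longrightarrow> c = 0)"


section \<open>Admissible enumerations\<close>

definition ordered_word :: "nat \<Rightarrow> (nat \<Rightarrow> 'a) \<Rightarrow> (nat \<Rightarrow> nat) \<Rightarrow> 'a list" where
  "ordered_word n x \<alpha> = concat (map (\<lambda>i. replicate (\<alpha> i) (x i)) [1..<n + 1])"

definition index_pairs :: "nat \<Rightarrow> (nat \<times> nat) set" where
  "index_pairs n = {(i, j). 1 \<le> i \<and> i < j \<and> j \<le> n}"

text \<open>The function \<open>f\<close> below sends \<open>(i, j)\<close> to \<open>(i', j')\<close>, where \<open>x\<^sub>j x\<^sub>i = x\<^sub>i\<^sub>' x\<^sub>j\<^sub>'\<close> is the
  relation with left-hand side \<open>x\<^sub>j x\<^sub>i\<close>; \<open>D\<close> is the set of these relations, oriented from left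
  to right, and \<open>quad_rels X r\<close> contains each of them in both orientations.\<close>

definition admissible ::
    "'k::field itself \<Rightarrow> 'a set \<Rightarrow> ('a \<times> 'a \<Rightarrow> 'a \<times> 'a) \<Rightarrow> nat \<Rightarrow> (nat \<Rightarrow> 'a) \<Rightarrow> bool" where
  "admissible K X r n x \<longleftrightarrow>
     bij_betw x {1..n} X \<and>
     (\<exists>f D. D = (\<lambda>(i, j). ([x j, x i], [x (fst (f (i, j))), x (snd (f (i, j)))])) ` index_pairs n \<and>
        quad_rels X r = D \<union> D\<inverse> \<and>
        card D = n choose 2 \<and>
        (\<forall>(i, j)\<in>index_pairs n. f (i, j) \<in> index_pairs n \<and> fst (f (i, j)) < j) \<and>
        (\<forall>(i, j)\<in>index_pairs n. [x i, x j] \<in> snd ` D)) \<and>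
     algebra_basis K X r (range (ordered_word n x))"


section \<open>Well-definedness\<close>

text \<open>The presented structures are a group and a ring respectively; in particular the ideal
  above is generated inside a genuine ring.\<close>

lemma word_cong_lists: "word_cong B E u v \<Longrightarrow> u \<in> lists B \<and> v \<in> lists B"
  by (induction rule: word_cong.induct) auto

lemma word_class_eq_iff:
  assumes "u \<in> lists B"
  shows "word_class B E u = word_class B E v \<longleftrightarrow> word_cong B E u v"
proof
  assume "word_class B E u = word_class B E v"
  with assms word_cong.refl[of u B E] have "word_cong B E v u"
    by (auto simp: word_class_def)
  then show "word_cong B E u v" by (rule word_cong.sym)
next
  assume "word_cong B E u v"
  then show "word_class B E u = word_class B E v"
    by (auto simp: word_class_def intro: word_cong.sym word_cong.trans)
qed

lemma presented_monoid_mult: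
  assumes "u \<in> lists B" "v \<in> lists B"
  shows "word_class B E u \<otimes>\<^bsub>presented_monoid B E\<^esub> word_class B E v = word_class B E (u @ v)"
proof -
  have "word_class B E (a @ b) = word_class B E (u @ v)"
    if "word_cong B E u a" "word_cong B E v b" for a b
    using that word_class_eq_iff[of "u @ v" B E "a @ b"] assms
    by (auto intro: word_cong.append)
  moreover have "word_cong B E u u" "word_cong B E v v"
    using assms by (auto intro: word_cong.refl)
  ultimately show ?thesis
    unfolding presented_monoid_def monoid.simps word_class_def[of B E u] word_class_def[of B E v]
    by blast
qed

lemma group_presented_group: "group (presented_group X E)"
proof -
  define B where "B = X \<times> (UNIV :: bool set)"
  define R where "R = group_rels X E"
  have G: "presented_group X E = presented_monoid B R"
    by (simp add: presented_group_def B_def R_def)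
  have carr: "carrier (presented_monoid B R) = word_class B R ` lists B"
    and one: "\<one>\<^bsub>presented_monoid B R\<^esub> = word_class B R []"
    by (simp_all add: presented_monoid_def)
  have inv: "\<exists>v\<in>lists B. word_cong B R (v @ u) []" if "u \<in> lists B" for u
    using that
  proof (induction u rule: lists.induct)
    case Nil
    show ?case by (rule bexI[of _ "[]"]) (auto intro: word_cong.refl)
  next
    case (Cons l u)
    obtain x b where l: "l = (x, b)" "x \<in> X" using Cons by (auto simp: B_def)
    obtain v where v: "v \<in> lists B" "word_cong B R (v @ u) []" using Cons by blast
    have "([(x, \<not> b), (x, b)], []) \<in> R"
      using l by (auto simp: R_def group_rels_def)
    then have "word_cong B R [(x, \<not> b), (x, b)] []"
      using l by (intro word_cong.rel) (auto simp: B_def)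
    then have "word_cong B R (v @ [(x, \<not> b), (x, b)] @ u) (v @ [] @ u)"
      using v Cons by (intro word_cong.append word_cong.refl) auto
    then have "word_cong B R ((v @ [(x, \<not> b)]) @ l # u) []"
      using v l by (auto intro: word_cong.trans)
    moreover have "v @ [(x, \<not> b)] \<in> lists B" using v l by (auto simp: B_def)
    ultimately show ?case by blast
  qed
  show ?thesis
    unfolding G
  proof (rule groupI)
    fix a assume "a \<in> carrier (presented_monoid B R)"
    then obtain u where u: "u \<in> lists B" "a = word_class B R u" by (auto simp: carr)
    obtain v where v: "v \<in> lists B" "word_cong B R (v @ u) []" using inv u by blast
    have "word_class B R v \<otimes>\<^bsub>presented_monoid B R\<^esub> a = \<one>\<^bsub>presented_monoid B R\<^esub>"
      using u v word_class_eq_iff[of "v @ u" B R "[]"]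
      by (simp add: presented_monoid_mult one)
    then show "\<exists>b\<in>carrier (presented_monoid B R).
        b \<otimes>\<^bsub>presented_monoid B R\<^esub> a = \<one>\<^bsub>presented_monoid B R\<^esub>"
      using v by (auto simp: carr)
  next
    fix a b c assume "a \<in> carrier (presented_monoid B R)" "b \<in> carrier (presented_monoid B R)"
      "c \<in> carrier (presented_monoid B R)"
    then obtain u v w where "u \<in> lists B" "v \<in> lists B" "w \<in> lists B"
      "a = word_class B R u" "b = word_class B R v" "c = word_class B R w"
      by (auto simp: carr simp del: in_lists_conv_set)
    then show "a \<otimes>\<^bsub>presented_monoid B R\<^esub> b \<otimes>\<^bsub>presented_monoid B R\<^esub> c =
        a \<otimes>\<^bsub>presented_monoid B R\<^esub> (b \<otimes>\<^bsub>presented_monoid B R\<^esub> c)"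
      by (simp add: presented_monoid_mult del: in_lists_conv_set)
  next
    fix a b assume "a \<in> carrier (presented_monoid B R)" "b \<in> carrier (presented_monoid B R)"
    then obtain u v where "u \<in> lists B" "v \<in> lists B"
      "a = word_class B R u" "b = word_class B R v"
      by (auto simp: carr simp del: in_lists_conv_set)
    then show "a \<otimes>\<^bsub>presented_monoid B R\<^esub> b \<in> carrier (presented_monoid B R)"
      by (auto simp: presented_monoid_mult carr simp del: in_lists_conv_set)
  next
    fix a assume "a \<in> carrier (presented_monoid B R)"
    then obtain u where "u \<in> lists B" "a = word_class B R u"
      by (auto simp: carr simp del: in_lists_conv_set)
    then show "\<one>\<^bsub>presented_monoid B R\<^esub> \<otimes>\<^bsub>presented_monoid B R\<^esub> a = a"
      by (simp add: presented_monoid_mult one del: in_lists_conv_set)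
  qed (simp add: carr one)
qed

lemma ring_free_algebra: "ring (free_algebra X :: ('a list \<Rightarrow>\<^sub>0 'k::field) ring)"
proof (rule ringI)
  let ?A = "free_algebra X :: ('a list \<Rightarrow>\<^sub>0 'k) ring"
  have carr: "carrier ?A = {f. Poly_Mapping.keys f \<subseteq> lists X}"
    and ops: "mult ?A = (*)" "one ?A = 1" "zero ?A = 0" "add ?A = (+)"
    by (simp_all add: free_algebra_def)
  show "abelian_group ?A"
  proof (rule abelian_groupI)
    fix f g assume "f \<in> carrier ?A" "g \<in> carrier ?A"
    then show "f \<oplus>\<^bsub>?A\<^esub> g \<in> carrier ?A"
      using Poly_Mapping.keys_add[of f g] by (auto simp: carr ops)
  next
    fix f assume "f \<in> carrier ?A"
    then show "\<exists>g\<in>carrier ?A. g \<oplus>\<^bsub>?A\<^esub> f = \<zero>\<^bsub>?A\<^esub>"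
      by (intro bexI[of _ "- f"]) (auto simp: carr ops)
  qed (auto simp: carr ops algebra_simps)
  show "monoid ?A"
  proof (rule monoidI)
    fix f g assume "f \<in> carrier ?A" "g \<in> carrier ?A"
    then show "f \<otimes>\<^bsub>?A\<^esub> g \<in> carrier ?A"
      using Poly_Mapping.keys_mult[of f g] by (fastforce simp: carr ops plus_list_def)
  qed (auto simp: carr ops algebra_simps zero_list_def)
qed (auto simp: free_algebra_def algebra_simps)

end

theory Submission
  imports Defs "HOL-Combinatorics.Permutations"
begin

text \<open>Letting the letter \<open>x\<close> act on \<open>\<int>\<^sup>X\<close> by \<open>v \<mapsto> e\<^sub>x + \<L>\<^sub>x v\<close> defines an action of \<open>G\<close>; write
  \<open>\<pi> u = u \<sqdot> 0\<close>. On positive words \<open>\<pi>\<close> is a complete invariant, and \<open>x\<^sup>p\<close> acts by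
  \<open>v \<mapsto> v + p e\<^sub>x\<close>, since \<open>\<L>\<^sub>x x = x\<close> and \<open>\<L>\<^sub>x\<^sup>p = 1\<close>. Hence \<open>x\<^sup>p z = z y\<^sup>p\<close> with \<open>\<L>\<^sub>z y = x\<close>, so \<open>p\<close>-th
  powers can be moved to the right of any word; after sorting with the rewriting rules of an
  admissible enumeration this gives \<open>G = Y F\<close>. Uniqueness is a count: \<open>\<pi>\<close> modulo \<open>p\<close> is constant
  on the cosets \<open>y F\<close> and takes all \<open>p\<^sup>n\<close> values, while \<open>Y\<close> has at most \<open>p\<^sup>n\<close> elements.\<close>

section \<open>Sorted words\<close>

lemma not_sorted_descent:
  "\<not> sorted xs \<Longrightarrow> \<exists>us a b vs. xs = us @ a # b # vs \<and> b < (a :: 'b :: linorder)"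
proof (induction xs rule: induct_list012)
  case (3 x y zs)
  show ?case
  proof (cases "x \<le> y")
    case True
    then have "\<not> sorted (y # zs)" using 3(3) unfolding sorted2 by blast
    then obtain us a b vs where "y # zs = us @ a # b # vs" "b < a" using 3(2) by blast
    then show ?thesis by (intro exI[of _ "x # us"]) auto
  next
    case False
    then show ?thesis by (intro exI[of _ "[]"]) auto
  qed
qed auto

text \<open>Induction on \<open>n\<close>: sortedness puts all copies of the largest index
  \<open>Suc n\<close> into one block at the end, whose length becomes the last exponent.\<close>

lemma sorted_eq_ordered_word:
  "sorted js \<Longrightarrow> js \<in> lists {1..n} \<Longrightarrow> \<exists>\<alpha>. map x js = ordered_word n x \<alpha>"
proof (induction n arbitrary: js)
  case 0
  then show ?case by (cases js) (auto simp: ordered_word_def)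
next
  case (Suc n)
  have split: "js = filter (\<lambda>i. i \<le> n) js @ filter (\<lambda>i. \<not> i \<le> n) js"
    using Suc.prems(1)
  proof (induction js)
    case (Cons a js)
    show ?case
    proof (cases "a \<le> n")
      case False
      then have "filter (\<lambda>i. i \<le> n) js = []"
        using Cons.prems by (auto simp: filter_empty_conv)
      then show ?thesis using False Cons by simp
    qed (use Cons in simp)
  qed simp
  have last: "filter (\<lambda>i. \<not> i \<le> n) js = replicate k (Suc n)"
    if "k = length (filter (\<lambda>i. \<not> i \<le> n) js)" for k
    unfolding that using Suc.prems(2)
    by (intro replicate_length_same[symmetric]) (auto simp: le_Suc_eq)
  have "filter (\<lambda>i. i \<le> n) js \<in> lists {1..n}" using Suc.prems(2) by auto
  then obtain \<alpha> where \<alpha>: "map x (filter (\<lambda>i. i \<le> n) js) = ordered_word n x \<alpha>"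
    using Suc.IH[OF sorted_wrt_filter[OF Suc.prems(1), of "\<lambda>i. i \<le> n"]] by blast
  define k where "k = length (filter (\<lambda>i. \<not> i \<le> n) js)"
  have "map x js = ordered_word n x \<alpha> @ replicate k (x (Suc n))"
    using split last[OF k_def] \<alpha> by (metis map_append map_replicate)
  also have "\<dots> = ordered_word (Suc n) x (\<alpha>(Suc n := k))"
    by (auto simp: ordered_word_def intro!: arg_cong[of _ _ concat])
  finally show ?case by blast
qed

text \<open>Extracts the rewriting rule for a descent. The bound \<open>i' < j\<close> is what makes
  sorting terminate.\<close>

lemma admissible_descent:
  assumes "admissible K X r n x" "1 \<le> i" "i < j" "j \<le> n"
  shows "\<exists>i' j'. i' \<in> {1..n} \<and> j' \<in> {1..n} \<and> i' < j \<and>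
    ([x j, x i], [x i', x j']) \<in> quad_rels X r"
proof -
  obtain f D where D: "D = (\<lambda>(i, j). ([x j, x i], [x (fst (f (i, j))), x (snd (f (i, j)))])) ` index_pairs n"
    "quad_rels X r = D \<union> D\<inverse>"
    "\<forall>(i, j)\<in>index_pairs n. f (i, j) \<in> index_pairs n \<and> fst (f (i, j)) < j"
    using assms(1) unfolding admissible_def by blast
  have ij: "(i, j) \<in> index_pairs n" using assms by (simp add: index_pairs_def)
  obtain i' j' where f: "f (i, j) = (i', j')" by (metis surj_pair)
  have "([x j, x i], [x i', x j']) \<in> D" unfolding D(1) by (rule image_eqI[OF _ ij]) (simp add: f)
  then have "([x j, x i], [x i', x j']) \<in> quad_rels X r" unfolding D(2) by (rule UnI1)
  moreover have "f (i, j) \<in> index_pairs n" "fst (f (i, j)) < j" using D(3) ij by auto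
  ultimately show ?thesis
    unfolding f index_pairs_def by (intro exI[of _ i'] exI[of _ j']) auto
qed

section \<open>The affine action on integer vectors\<close>

locale square_free_solution =
  fixes X :: "'a set" and r :: "'a \<times> 'a \<Rightarrow> 'a \<times> 'a"
  assumes finite_X: "finite X" and sol: "solution X r" and sqfree: "square_free X r"
begin

text \<open>Outside \<open>X\<close> the map \<open>r\<close> is arbitrary, so the left action is
  extended by the identity there. This makes each \<open>lact x\<close> a permutation of the whole
  type, with a total inverse \<open>linv x\<close>.\<close>

definition lact :: "'a \<Rightarrow> 'a \<Rightarrow> 'a" where
  "lact x y = (if x \<in> X \<and> y \<in> X then left_act r x y else y)"

lemma r_closed: "x \<in> X \<Longrightarrow> y \<in> X \<Longrightarrow> r (x, y) \<in> X \<times> X"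
  using sol unfolding solution_def by (meson bij_betwE mem_Sigma_iff)

lemma r_invol: "x \<in> X \<Longrightarrow> y \<in> X \<Longrightarrow> r (r (x, y)) = (x, y)"
  using sol unfolding solution_def involutive_def by blast

lemma lact_permutes: "lact x permutes X"
proof (cases "x \<in> X")
  case True
  then have "bij_betw (left_act r x) X X"
    using sol unfolding solution_def nondegenerate_def by blast
  then have "bij_betw (lact x) X X"
    using True by (subst bij_betw_cong[of X _ "left_act r x"]) (auto simp: lact_def)
  then show ?thesis by (rule bij_imp_permutes) (simp add: lact_def)
next
  case False
  then have "lact x = id" by (auto simp: lact_def)
  then show ?thesis by (simp only: permutes_id)
qed

abbreviation linv :: "'a \<Rightarrow> 'a \<Rightarrow> 'a" where "linv x \<equiv> inv_into UNIV (lact x)"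

lemmas bij_lact = permutes_bij[OF lact_permutes]
lemmas inv_lact = permutes_inverses[OF lact_permutes]

lemma inv_lact_eq_iff: "linv x u = y \<longleftrightarrow> u = lact x y"
  by (metis inv_lact)

lemma lact_closed: "y \<in> X \<Longrightarrow> lact x y \<in> X"
  by (simp add: permutes_in_image[OF lact_permutes])

lemma inv_lact_closed: "y \<in> X \<Longrightarrow> linv x y \<in> X"
  by (simp add: permutes_in_image[OF permutes_inv[OF lact_permutes]])

lemma lact_self: "lact x x = x"
  using sqfree by (auto simp: lact_def square_free_def left_act_def)

lemma inv_lact_self: "linv x x = x"
  by (simp add: inv_lact_eq_iff lact_self)

lemma lact_eq_self_iff: "lact x y = x \<longleftrightarrow> y = x"
  by (metis inv_lact(2) lact_self)

text \<open>The second claim is involutivity; the third compares first components in the Yang-Baxter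
  equation at \<open>(x, y, u)\<close>.\<close>

lemma lact_rel:
  assumes "x \<in> X" "y \<in> X" "r (x, y) = (z, t)"
  shows "z = lact x y" "lact z t = x" "lact x (lact y u) = lact z (lact t u)"
proof -
  have zt: "z \<in> X" "t \<in> X" using r_closed[OF assms(1,2)] assms(3) by auto
  show "z = lact x y" using assms by (simp add: lact_def left_act_def)
  show "lact z t = x"
    using r_invol[OF assms(1,2)] assms(3) zt by (simp add: lact_def left_act_def)
  show "lact x (lact y u) = lact z (lact t u)"
  proof (cases "u \<in> X")
    case True
    have "r12 r (r23 r (r12 r (x, y, u))) = r23 r (r12 r (r23 r (x, y, u)))"
      using sol assms True unfolding solution_def yang_baxter_def by blast
    then have "left_act r z (left_act r t u) = left_act r x (left_act r y u)"
      using assms by (simp add: r12_def r23_def left_act_def split: prod.splits)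
    moreover have "left_act r t u \<in> X" "left_act r y u \<in> X"
      using lact_closed[OF True, of t] lact_closed[OF True, of y] True zt assms
      by (simp_all add: lact_def)
    ultimately show ?thesis using assms True zt by (simp add: lact_def)
  next
    case False
    then show ?thesis by (simp add: lact_def)
  qed
qed

text \<open>The letter \<open>x\<close> acts on \<open>\<int>\<^sup>X\<close> by the affine map \<open>v \<mapsto> e\<^sub>x + \<L>\<^sub>x v\<close>, and \<open>(x, False)\<close> by its
  inverse; the orbit map of \<open>0\<close> is the bijective cocycle \<open>G \<rightarrow> \<int>\<^sup>X\<close>.\<close>

definition letter_act :: "'a \<times> bool \<Rightarrow> ('a \<Rightarrow> int) \<Rightarrow> 'a \<Rightarrow> int" where
  "letter_act l v = (if snd l then (\<lambda>y. of_bool (y = fst l) + v (linv (fst l) y))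
     else (\<lambda>y. v (lact (fst l) y) - of_bool (y = fst l)))"

definition word_act :: "('a \<times> bool) list \<Rightarrow> ('a \<Rightarrow> int) \<Rightarrow> 'a \<Rightarrow> int" where
  "word_act w = foldr letter_act w"

lemma word_act_Nil [simp]: "word_act [] v = v"
  and word_act_Cons [simp]: "word_act (l # w) v = letter_act l (word_act w v)"
  and word_act_append [simp]: "word_act (u @ w) v = word_act u (word_act w v)"
  by (simp_all add: word_act_def)

abbreviation letters :: "('a \<times> bool) set" where "letters \<equiv> X \<times> UNIV"
abbreviation rels where "rels \<equiv> group_rels X (quad_rels X r)"
abbreviation cong (infix "\<approx>" 50) where "u \<approx> v \<equiv> word_cong letters rels u v"
abbreviation cls where "cls \<equiv> word_class letters rels"

text \<open>Square-freeness gives \<open>lact x x = x\<close>, so the unit vector at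
  \<open>x\<close> is fixed by the permutation and may be subtracted after the permutation has been
  undone.\<close>

lemma letter_act_inverse: "letter_act (x, b) (letter_act (x, \<not> b) v) = v"
  by (cases b) (auto simp: letter_act_def inv_lact lact_self lact_eq_self_iff inv_lact_eq_iff fun_eq_iff)

text \<open>The action descends to \<open>G\<close>. For \<open>xy = zt\<close> both words translate
  by the sum of the unit vectors at \<open>x\<close> and \<open>z\<close>, because
  \<open>lact x y = z\<close> and \<open>lact z t = x\<close>, and their permutation parts agree by
  \<open>lact_rel(3)\<close>.\<close>

lemma word_act_cong: "u \<approx> w \<Longrightarrow> word_act u v = word_act w v"
proof (induction arbitrary: v rule: word_cong.induct)
  case (rel u w)
  from rel(1) consider
    x y z t where "u = pos_word [x, y]" "w = pos_word [z, t]" "x \<in> X" "y \<in> X" "r (x, y) = (z, t)"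
    | x b where "u = [(x, b), (x, \<not> b)]" "w = []"
    unfolding group_rels_def quad_rels_def by blast
  then show ?case
  proof cases
    case 1
    note rel = lact_rel[OF 1(3-5)]
    have "linv y (linv x a) = linv t (linv z a)" for a
      by (metis inv_lact rel(3))
    moreover have "linv x a = y \<longleftrightarrow> a = z" "linv z a = t \<longleftrightarrow> a = x" for a
      by (simp_all add: inv_lact_eq_iff rel(2) rel(1)[symmetric])
    ultimately show ?thesis
      by (simp add: 1(1,2) pos_word_def letter_act_def fun_eq_iff)
  next
    case 2
    then show ?thesis by (simp add: letter_act_inverse)
  qed
qed auto

section \<open>Positive words are determined in \<open>G\<close> by the orbit of 0\<close>

lemma pos_word_lists: "w \<in> lists X \<Longrightarrow> pos_word w \<in> lists letters"
  by (auto simp: pos_word_def)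

lemma pos_word_append: "pos_word (u @ v) = pos_word u @ pos_word v"
  by (simp add: pos_word_def)

lemma pos_word_Cons: "pos_word (x # w) = (x, True) # pos_word w"
  by (simp add: pos_word_def)

lemma word_act_pos_nonneg: "0 \<le> word_act (pos_word w) (\<lambda>_. 0) y"
  by (induction w arbitrary: y) (auto simp: pos_word_def letter_act_def)

lemma cong_Cons:
  assumes "x \<in> X" "pos_word u \<approx> pos_word v"
  shows "pos_word (x # u) \<approx> pos_word (x # v)"
  using word_cong.append[OF word_cong.refl assms(2), of "[(x, True)]"] assms
  by (simp add: pos_word_Cons)

lemma cong_quad:
  assumes "x \<in> X" "y \<in> X" "r (x, y) = (z, t)"
  shows "pos_word [x, y] \<approx> pos_word [z, t]"
proof (cases "(x, y) = (z, t)")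
  case True
  then show ?thesis using assms by (auto simp: pos_word_def intro!: word_cong.refl)
next
  case False
  have "z \<in> X" "t \<in> X" using r_closed[OF assms(1,2)] assms(3) by auto
  with assms False have "([x, y], [z, t]) \<in> quad_rels X r"
    unfolding quad_rels_def by blast
  then have "(pos_word [x, y], pos_word [z, t]) \<in> rels"
    unfolding group_rels_def by blast
  then show ?thesis
    using assms \<open>z \<in> X\<close> \<open>t \<in> X\<close> by (intro word_cong.rel) (auto simp: pos_word_def)
qed

text \<open>If \<open>x \<noteq> z\<close> occurs in front of a word starting with \<open>y = \<L>\<^sub>x\<^sup>-\<^sup>1 z\<close>, the relation for
  \<open>xy\<close> brings \<open>z\<close> to the front.\<close>
lemma pull_letter:
  assumes "w \<in> lists X" "word_act (pos_word w) (\<lambda>_. 0) z > 0" "z \<in> X"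
  shows "\<exists>w'\<in>lists X. pos_word w \<approx> pos_word (z # w')"
  using assms
proof (induction w arbitrary: z)
  case Nil
  then show ?case by (simp add: pos_word_def)
next
  case (Cons x w)
  have x: "x \<in> X" and w: "w \<in> lists X" using Cons.hyps by auto
  show ?case
  proof (cases "z = x")
    case True
    have "pos_word (x # w) \<approx> pos_word (z # w)"
      unfolding True using x w by (intro word_cong.refl pos_word_lists) auto
    then show ?thesis using w by blast
  next
    case False
    define y where "y = linv x z"
    have y: "y \<in> X" "lact x y = z"
      using Cons.prems(2) by (auto simp: y_def inv_lact inv_lact_closed)
    have "word_act (pos_word w) (\<lambda>_. 0) y > 0"
      using Cons.prems(1) False by (simp add: pos_word_Cons letter_act_def y_def)
    then obtain w' where w': "w' \<in> lists X" "pos_word w \<approx> pos_word (y # w')"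
      using Cons.IH w y by blast
    obtain t where t: "r (x, y) = (z, t)"
      using lact_rel(1)[OF x y(1)] y(2) by (metis surj_pair)
    then have tX: "t \<in> X" using r_closed[OF x y(1)] by auto
    have "pos_word (x # w) \<approx> pos_word (x # y # w')"
      using cong_Cons x w' by blast
    moreover have "pos_word ([x, y] @ w') \<approx> pos_word ([z, t] @ w')"
      unfolding pos_word_append using cong_quad[OF x y(1) t] pos_word_lists[OF w'(1)]
      by (intro word_cong.append word_cong.refl)
    ultimately have "pos_word (x # w) \<approx> pos_word (z # t # w')"
      by (auto intro: word_cong.trans)
    then show ?thesis using tX w' by (intro bexI[of _ "t # w'"]) auto
  qed
qed

text \<open>A nonempty positive word has a positive coordinate at its first letter \<open>x\<close>.
  Equal orbits thus let \<open>pull_letter\<close> bring \<open>x\<close> to the front of the other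
  word, and the invertible action of \<open>x\<close> cancels.\<close>

lemma pos_word_cong_iff:
  assumes "u \<in> lists X" "w \<in> lists X"
  shows "pos_word u \<approx> pos_word w \<longleftrightarrow>
    word_act (pos_word u) (\<lambda>_. 0) = word_act (pos_word w) (\<lambda>_. 0)"
proof
  show "word_act (pos_word u) (\<lambda>_. 0) = word_act (pos_word w) (\<lambda>_. 0) \<Longrightarrow> pos_word u \<approx> pos_word w"
    using assms
  proof (induction u arbitrary: w)
    case Nil
    show ?case
    proof (cases w)
      case Nil
      then show ?thesis by (auto simp: pos_word_def intro: word_cong.refl)
    next
      case (Cons x w')
      then have "word_act (pos_word w) (\<lambda>_. 0) x > 0"
        using word_act_pos_nonneg[of w' "linv x x"]
        by (simp add: pos_word_Cons letter_act_def)
      then show ?thesis using Nil.prems by (metis pos_word_def list.map(1) word_act_Nil less_irrefl)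
    qed
  next
    case (Cons x u)
    have x: "x \<in> X" and u: "u \<in> lists X" using Cons.hyps by auto
    have "word_act (pos_word (x # u)) (\<lambda>_. 0) x > 0"
      using word_act_pos_nonneg[of u "linv x x"]
      by (simp add: pos_word_Cons letter_act_def)
    then obtain w' where w': "w' \<in> lists X" "pos_word w \<approx> pos_word (x # w')"
      using pull_letter[of w x] Cons.prems x by metis
    have "word_act (pos_word (x # u)) (\<lambda>_. 0) = word_act (pos_word (x # w')) (\<lambda>_. 0)"
      using word_act_cong[OF w'(2)] Cons.prems(1) by metis
    then have "word_act (pos_word u) (\<lambda>_. 0) = word_act (pos_word w') (\<lambda>_. 0)"
      unfolding pos_word_Cons word_act_Cons by (metis letter_act_inverse)
    then have "pos_word (x # u) \<approx> pos_word (x # w')"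
      using Cons.IH u w'(1) cong_Cons[OF x] by blast
    then show ?case using w'(2) by (auto intro: word_cong.sym word_cong.trans)
  qed
qed (rule word_act_cong)

section \<open>The cyclic degree\<close>

definition p :: nat where "p = cyclic_degree X r"

lemma restrict_lact_Bij: "x \<in> X \<Longrightarrow> restrict (left_act r x) X \<in> Bij X"
  using sol unfolding solution_def nondegenerate_def Bij_def
  by (auto simp: bij_betw_restrict_eq)

lemma finite_Bij: "finite (Bij X)"
proof -
  have "Bij X \<subseteq> X \<rightarrow>\<^sub>E X"
    by (auto simp: Bij_def PiE_def dest: bij_betwE)
  then show ?thesis using finite_X by (meson finite_PiE finite_subset)
qed

text \<open>\<open>ord\<close> is 0 on elements of infinite order, and a single 0 would make
  \<open>Lcm\<close> vanish; finiteness of \<open>Bij X\<close> excludes this.\<close>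

lemma p_pos: "p > 0"
proof -
  interpret B: group "BijGroup X" by (rule group_BijGroup)
  have "B.ord a > 0" if "a \<in> Bij X" for a
    using B.ord_ge_1[of a] that finite_Bij by (simp add: BijGroup_def Suc_le_eq)
  then have "0 \<notin> (\<lambda>x. B.ord (restrict (left_act r x) X)) ` X"
    using restrict_lact_Bij by force
  then show ?thesis
    unfolding p_def cyclic_degree_def using finite_X by (auto simp: Lcm_0_iff intro: Nat.gr0I)
qed

text \<open>Bridge from the group powers that define the order to iterates, the form in which powers
  of a letter act on vectors.\<close>

lemma BijGroup_pow:
  assumes "x \<in> X"
  shows "restrict (left_act r x) X [^]\<^bsub>BijGroup X\<^esub> k = restrict (lact x ^^ k) X"
proof (induction k)
  case 0
  then show ?case by (simp add: BijGroup_def)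
next
  case (Suc k)
  interpret B: group "BijGroup X" by (rule group_BijGroup)
  have a: "restrict (left_act r x) X \<in> carrier (BijGroup X)"
    using restrict_lact_Bij[OF assms] by (simp add: BijGroup_def)
  have b: "restrict (lact x ^^ k) X \<in> carrier (BijGroup X)"
    using B.nat_pow_closed[OF a, of k] unfolding Suc .
  have "restrict (left_act r x) X [^]\<^bsub>BijGroup X\<^esub> Suc k =
      restrict (lact x ^^ k) X \<otimes>\<^bsub>BijGroup X\<^esub> restrict (left_act r x) X"
    by (simp only: B.nat_pow_Suc Suc.IH)
  also have "\<dots> = compose X (restrict (lact x ^^ k) X) (restrict (left_act r x) X)"
    using a b unfolding BijGroup_def partial_object.simps monoid.simps
    by (simp only: restrict_apply')
  also have "\<dots> = restrict (lact x ^^ Suc k) X"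
  proof
    fix y
    have "left_act r x y = lact x y" "lact x y \<in> X" if "y \<in> X"
      using that assms lact_closed[OF that, of x] by (simp_all add: lact_def)
    then show "compose X (restrict (lact x ^^ k) X) (restrict (left_act r x) X) y =
        restrict (lact x ^^ Suc k) X y"
      by (simp add: compose_def funpow_swap1)
  qed
  finally show ?case .
qed

lemma lact_pow_p: "lact x ^^ p = id"
proof (cases "x \<in> X")
  case False
  then have "lact x = id" by (auto simp: lact_def)
  then show ?thesis by simp
next
  case True
  interpret B: group "BijGroup X" by (rule group_BijGroup)
  have a: "restrict (left_act r x) X \<in> carrier (BijGroup X)"
    using restrict_lact_Bij[OF True] by (simp add: BijGroup_def)
  have "B.ord (restrict (left_act r x) X) dvd p"
    unfolding p_def cyclic_degree_def using True by (intro dvd_Lcm) auto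
  then have "restrict (left_act r x) X [^]\<^bsub>BijGroup X\<^esub> p = \<one>\<^bsub>BijGroup X\<^esub>"
    using B.pow_eq_id[OF a] by blast
  then have eq: "restrict (lact x ^^ p) X = restrict id X"
    using BijGroup_pow[OF True] by (auto simp: BijGroup_def)
  have "(lact x ^^ p) y = y" for y
  proof (cases "y \<in> X")
    case True
    then show ?thesis using fun_cong[OF eq, of y] by simp
  next
    case False
    then have "(lact x ^^ k) y = y" for k by (induction k) (auto simp: lact_def)
    then show ?thesis .
  qed
  then show ?thesis by auto
qed

text \<open>\<open>lact x\<close> fixes \<open>x\<close>, so all \<open>k\<close> letters add to the
  same coordinate.\<close>

lemma word_act_replicate:
  "word_act (replicate k (x, True)) v y = (if y = x then int k else 0) + v ((linv x ^^ k) y)"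
  by (induction k arbitrary: y)
    (auto simp: letter_act_def inv_lact_eq_iff lact_self inv_lact_self funpow_swap1)

lemma word_act_power:
  "word_act (replicate p (x, True)) v = (\<lambda>y. (if y = x then int p else 0) + v y)"
  using inv_fn[OF bij_lact, of p x] lact_pow_p[of x]
  by (intro ext) (simp add: word_act_replicate)

section \<open>The subgroup generated by the powers\<close>

abbreviation G where "G \<equiv> assoc_group X r"
abbreviation elt where "elt \<equiv> to_group X r"

sublocale G: group "assoc_group X r"
  unfolding assoc_group_def by (rule group_presented_group)

text \<open>Generated over all letters of \<open>X\<close>, hence independent of any enumeration;
  the final theorem matches it with the generators indexed by \<open>{1..n}\<close>.\<close>

definition F where "F = generate G {elt [x] [^]\<^bsub>G\<^esub> p | x. x \<in> X}"

lemma carrier_G: "carrier G = cls ` lists letters"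
  by (simp add: assoc_group_def presented_group_def presented_monoid_def)

lemma one_G: "\<one>\<^bsub>G\<^esub> = cls []"
  by (simp add: assoc_group_def presented_group_def presented_monoid_def)

lemma cls_mult:
  "u \<in> lists letters \<Longrightarrow> w \<in> lists letters \<Longrightarrow> cls u \<otimes>\<^bsub>G\<^esub> cls w = cls (u @ w)"
  unfolding assoc_group_def presented_group_def by (rule presented_monoid_mult)

lemma elt_closed [simp]: "w \<in> lists X \<Longrightarrow> elt w \<in> carrier G"
  using pos_word_lists[of w] unfolding to_group_def carrier_G by (rule imageI)

lemma elt_append: "u \<in> lists X \<Longrightarrow> w \<in> lists X \<Longrightarrow> elt (u @ w) = elt u \<otimes>\<^bsub>G\<^esub> elt w"
  using pos_word_lists[of u] pos_word_lists[of w]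
  by (simp only: to_group_def pos_word_append cls_mult)

lemma elt_Cons: "x \<in> X \<Longrightarrow> w \<in> lists X \<Longrightarrow> elt (x # w) = elt [x] \<otimes>\<^bsub>G\<^esub> elt w"
  using elt_append[of "[x]" w] by simp

lemma elt_Nil: "elt [] = \<one>\<^bsub>G\<^esub>"
  by (simp add: to_group_def one_G pos_word_def)

lemma replicate_lists: "x \<in> X \<Longrightarrow> replicate k x \<in> lists X"
  by (induction k) auto

lemma elt_replicate:
  assumes "x \<in> X"
  shows "elt (replicate k x) = elt [x] [^]\<^bsub>G\<^esub> k"
proof (induction k)
  case 0
  then show ?case by (simp add: elt_Nil)
next
  case (Suc k)
  have "elt (replicate (Suc k) x) = elt (replicate k x @ [x])"
    by (simp add: replicate_append_same)
  also have "\<dots> = elt [x] [^]\<^bsub>G\<^esub> Suc k"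
    using Suc elt_append[of "replicate k x" "[x]"] assms replicate_lists[OF assms] by simp
  finally show ?case .
qed

lemma elt_eq_iff:
  assumes "u \<in> lists X" "w \<in> lists X"
  shows "elt u = elt w \<longleftrightarrow>
    word_act (pos_word u) (\<lambda>_. 0) = word_act (pos_word w) (\<lambda>_. 0)"
  using pos_word_cong_iff[OF assms] word_class_eq_iff[OF pos_word_lists[OF assms(1)]]
  by (simp add: to_group_def)

lemma gens_closed: "{elt [x] [^]\<^bsub>G\<^esub> p | x. x \<in> X} \<subseteq> carrier G"
  by auto

lemma F_subgroup: "subgroup F G"
  unfolding F_def using gens_closed by (rule G.generate_is_subgroup)

lemma F_closed: "f \<in> F \<Longrightarrow> f \<in> carrier G"
  using F_subgroup by (rule subgroup.mem_carrier)

lemma power_in_F: "x \<in> X \<Longrightarrow> elt [x] [^]\<^bsub>G\<^esub> p \<in> F"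
  unfolding F_def by (intro generate.incl) blast

lemma power_pow_in_F: "x \<in> X \<Longrightarrow> elt [x] [^]\<^bsub>G\<^esub> (p * k) \<in> F"
proof (induction k)
  case 0
  then show ?case using subgroup.one_closed[OF F_subgroup] by simp
next
  case (Suc k)
  then have "elt [x] [^]\<^bsub>G\<^esub> p \<otimes>\<^bsub>G\<^esub> elt [x] [^]\<^bsub>G\<^esub> (p * k) \<in> F"
    by (intro subgroup.m_closed[OF F_subgroup] power_in_F)
  then show ?case using Suc.prems by (simp add: G.nat_pow_mult)
qed

text \<open>Both sides come from positive words, so it suffices to compare orbits of 0: each is the
  unit vector at \<open>z\<close> plus \<open>p\<close> times the one at \<open>x\<close>, since
  \<open>lact z\<close> sends \<open>linv z x\<close> to \<open>x\<close>.\<close>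

lemma power_comm_letter:
  assumes "x \<in> X" "z \<in> X"
  shows "elt [x] [^]\<^bsub>G\<^esub> p \<otimes>\<^bsub>G\<^esub> elt [z] = elt [z] \<otimes>\<^bsub>G\<^esub> elt [linv z x] [^]\<^bsub>G\<^esub> p"
proof -
  have y: "linv z x \<in> X" using assms inv_lact_closed by blast
  have eq: "pos_word (replicate k a) = replicate k (a, True)" for k a
    by (simp add: pos_word_def)
  have "linv z u = linv z x \<longleftrightarrow> u = x" for u
    by (metis inv_lact(1))
  then have "word_act (pos_word (replicate p x @ [z])) (\<lambda>_. 0) =
      word_act (pos_word ([z] @ replicate p (linv z x))) (\<lambda>_. 0)"
    unfolding pos_word_append eq word_act_append word_act_power
    by (auto simp: pos_word_def letter_act_def word_act_power fun_eq_iff)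
  then have "elt (replicate p x @ [z]) = elt ([z] @ replicate p (linv z x))"
    using assms y by (subst elt_eq_iff) (auto intro: replicate_lists)
  then show ?thesis
    using assms y by (simp only: elt_append elt_replicate replicate_lists lists.intros)
qed

lemma power_comm_word:
  assumes "w \<in> lists X" "x \<in> X"
  shows "\<exists>y\<in>X. elt [x] [^]\<^bsub>G\<^esub> p \<otimes>\<^bsub>G\<^esub> elt w = elt w \<otimes>\<^bsub>G\<^esub> elt [y] [^]\<^bsub>G\<^esub> p"
  using assms
proof (induction w arbitrary: x)
  case Nil
  then show ?case by (intro bexI[of _ x]) (simp_all add: elt_Nil)
next
  case (Cons z w)
  have y: "linv z x \<in> X" using Cons.prems inv_lact_closed by blast
  obtain y' where y': "y' \<in> X"
    "elt [linv z x] [^]\<^bsub>G\<^esub> p \<otimes>\<^bsub>G\<^esub> elt w = elt w \<otimes>\<^bsub>G\<^esub> elt [y'] [^]\<^bsub>G\<^esub> p"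
    using Cons.IH[OF y] by blast
  have c: "elt [x] \<in> carrier G" "elt [z] \<in> carrier G" "elt [linv z x] \<in> carrier G"
    "elt [y'] \<in> carrier G" "elt w \<in> carrier G"
    using Cons.hyps Cons.prems y y' by (auto intro!: elt_closed)
  have "elt [x] [^]\<^bsub>G\<^esub> p \<otimes>\<^bsub>G\<^esub> elt (z # w) = elt [x] [^]\<^bsub>G\<^esub> p \<otimes>\<^bsub>G\<^esub> elt [z] \<otimes>\<^bsub>G\<^esub> elt w"
    using c Cons.hyps by (simp add: elt_Cons[of z w] G.m_assoc)
  also have "\<dots> = elt [z] \<otimes>\<^bsub>G\<^esub> (elt [linv z x] [^]\<^bsub>G\<^esub> p \<otimes>\<^bsub>G\<^esub> elt w)"
    unfolding power_comm_letter[OF Cons.prems Cons.hyps(1)] using c by (simp add: G.m_assoc)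
  also have "\<dots> = elt (z # w) \<otimes>\<^bsub>G\<^esub> elt [y'] [^]\<^bsub>G\<^esub> p"
    using c Cons.hyps y' by (simp add: elt_Cons[of z w] G.m_assoc)
  finally show ?case using y'(1) by blast
qed

text \<open>Induction over generated elements: generators move by \<open>power_comm_word\<close>,
  inverses by inverting the powers in that relation, and products factor by factor.\<close>

lemma F_comm_word:
  assumes "f \<in> F" "w \<in> lists X"
  shows "\<exists>f'\<in>F. f \<otimes>\<^bsub>G\<^esub> elt w = elt w \<otimes>\<^bsub>G\<^esub> f'"
  using assms(1) unfolding F_def
proof (induction rule: generate.induct)
  case one
  then show ?case using assms(2) by (intro bexI[of _ "\<one>\<^bsub>G\<^esub>"] generate.one) simp
next
  case (incl h)
  then show ?case using power_comm_word[OF assms(2)] by (blast intro: generate.incl)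
next
  case (inv h)
  then obtain x where x: "x \<in> X" "h = elt [x] [^]\<^bsub>G\<^esub> p" by blast
  obtain y where y: "y \<in> X" "h \<otimes>\<^bsub>G\<^esub> elt w = elt w \<otimes>\<^bsub>G\<^esub> elt [y] [^]\<^bsub>G\<^esub> p"
    using power_comm_word[OF assms(2) x(1)] x(2) by blast
  define k where "k = elt [y] [^]\<^bsub>G\<^esub> p"
  have c: "h \<in> carrier G" "k \<in> carrier G" "elt w \<in> carrier G"
    using x y assms(2) by (simp_all add: k_def)
  \<comment> \<open>Inserting \<open>k\<close> and its inverse lets the relation
    \<open>h w = w k\<close> be applied from right to left.\<close>
  have "inv\<^bsub>G\<^esub> h \<otimes>\<^bsub>G\<^esub> elt w = inv\<^bsub>G\<^esub> h \<otimes>\<^bsub>G\<^esub> (elt w \<otimes>\<^bsub>G\<^esub> k) \<otimes>\<^bsub>G\<^esub> inv\<^bsub>G\<^esub> k"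
    using c by (simp add: G.m_assoc)
  also have "\<dots> = inv\<^bsub>G\<^esub> h \<otimes>\<^bsub>G\<^esub> (h \<otimes>\<^bsub>G\<^esub> elt w) \<otimes>\<^bsub>G\<^esub> inv\<^bsub>G\<^esub> k"
    using y by (simp add: k_def)
  also have "\<dots> = elt w \<otimes>\<^bsub>G\<^esub> inv\<^bsub>G\<^esub> k"
    using c by (simp add: G.m_assoc[symmetric])
  finally show ?case
    using y(1) by (intro bexI[of _ "inv\<^bsub>G\<^esub> k"]) (auto simp: k_def intro: generate.inv)
next
  case (eng h1 h2)
  then obtain f1 f2 where f: "f1 \<in> F" "h1 \<otimes>\<^bsub>G\<^esub> elt w = elt w \<otimes>\<^bsub>G\<^esub> f1"
    "f2 \<in> F" "h2 \<otimes>\<^bsub>G\<^esub> elt w = elt w \<otimes>\<^bsub>G\<^esub> f2"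
    by (auto simp: F_def)
  have c: "h1 \<in> carrier G" "h2 \<in> carrier G" "f1 \<in> carrier G" "f2 \<in> carrier G" "elt w \<in> carrier G"
    using eng f assms(2) F_closed by (simp_all add: F_def)
  have "h1 \<otimes>\<^bsub>G\<^esub> h2 \<otimes>\<^bsub>G\<^esub> elt w = h1 \<otimes>\<^bsub>G\<^esub> (h2 \<otimes>\<^bsub>G\<^esub> elt w)"
    using c by (simp add: G.m_assoc)
  also have "\<dots> = h1 \<otimes>\<^bsub>G\<^esub> elt w \<otimes>\<^bsub>G\<^esub> f2"
    unfolding f(4) using c by (simp add: G.m_assoc)
  also have "\<dots> = elt w \<otimes>\<^bsub>G\<^esub> (f1 \<otimes>\<^bsub>G\<^esub> f2)"
    unfolding f(2) using c by (simp add: G.m_assoc)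
  finally show ?case using f(1,3) by (auto simp: F_def intro: generate.eng)
qed

text \<open>Modulo \<open>F\<close> a formal inverse becomes a positive word: the inverse of
  \<open>x\<close> is \<open>x^(p-1)\<close> times the inverse of \<open>x^p\<close>. Positivity of
  \<open>p\<close> gives \<open>Suc (p - 1) = p\<close>.\<close>

lemma inverse_letter:
  assumes "x \<in> X"
  shows "cls [(x, False)] = elt (replicate (p - 1) x) \<otimes>\<^bsub>G\<^esub> inv\<^bsub>G\<^esub> (elt [x] [^]\<^bsub>G\<^esub> p)"
proof -
  let ?g = "elt [x]"
  have c: "?g \<in> carrier G" using assms by simp
  have m: "cls [(x, False)] \<in> carrier G" using assms unfolding carrier_G by (intro imageI) simp
  have "([(x, False), (x, True)], []) \<in> rels"
    using assms by (auto simp: group_rels_def)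
  then have "[(x, False), (x, True)] \<approx> []"
    using assms by (intro word_cong.rel) auto
  then have "cls [(x, False), (x, True)] = cls []"
    using assms by (subst word_class_eq_iff) auto
  then have "cls [(x, False)] \<otimes>\<^bsub>G\<^esub> ?g = \<one>\<^bsub>G\<^esub>"
    using assms by (simp add: to_group_def pos_word_def cls_mult one_G)
  then have "cls [(x, False)] = inv\<^bsub>G\<^esub> ?g"
    using c m by (simp add: G.inv_equality)
  also have "\<dots> = ?g [^]\<^bsub>G\<^esub> (p - 1) \<otimes>\<^bsub>G\<^esub> inv\<^bsub>G\<^esub> (?g [^]\<^bsub>G\<^esub> Suc (p - 1))"
    using c by (simp only: G.nat_pow_Suc2 G.inv_mult_group G.nat_pow_closed G.m_assoc[symmetric]
        G.inv_closed G.r_inv G.l_one)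
  finally show ?thesis
    using assms p_pos by (simp add: elt_replicate)
qed

text \<open>Letters are prepended one at a time. A positive letter joins \<open>w\<close>; an
  inverse letter contributes \<open>p - 1\<close> positive copies and an element of
  \<open>F\<close>, which \<open>F_comm_word\<close> moves to the right of \<open>w\<close>.\<close>

lemma carrier_decomp:
  assumes "g \<in> carrier G"
  shows "\<exists>w\<in>lists X. \<exists>f\<in>F. g = elt w \<otimes>\<^bsub>G\<^esub> f"
proof -
  obtain u where u: "u \<in> lists letters" "g = cls u" using assms carrier_G by auto
  have "\<exists>w\<in>lists X. \<exists>f\<in>F. cls u = elt w \<otimes>\<^bsub>G\<^esub> f"
    using u(1)
  proof (induction u)
    case Nil
    show ?case
      by (rule bexI[of _ "[]"], rule bexI[of _ "\<one>\<^bsub>G\<^esub>"])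
        (auto simp: elt_Nil one_G[symmetric] subgroup.one_closed[OF F_subgroup])
  next
    case (Cons l u)
    obtain x b where l: "l = (x, b)" "x \<in> X" using Cons.hyps by auto
    obtain w f where w: "w \<in> lists X" "f \<in> F" "cls u = elt w \<otimes>\<^bsub>G\<^esub> f" using Cons.IH by blast
    have c: "elt w \<in> carrier G" "f \<in> carrier G" "elt [x] \<in> carrier G"
      "elt (replicate (p - 1) x) \<in> carrier G"
      using w l F_closed replicate_lists[OF l(2)] by (auto intro!: elt_closed)
    have split: "cls (l # u) = cls [l] \<otimes>\<^bsub>G\<^esub> (elt w \<otimes>\<^bsub>G\<^esub> f)"
      using cls_mult[of "[l]" u] Cons.hyps w(3) by simp
    show ?case
    proof (cases b)
      case True
      then have "cls [l] = elt [x]" by (simp add: l to_group_def pos_word_def)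
      then have "cls (l # u) = elt (x # w) \<otimes>\<^bsub>G\<^esub> f"
        using split c w l by (simp add: elt_Cons[of x w] G.m_assoc)
      then show ?thesis using w l by (auto intro!: bexI[of _ "x # w"] bexI[of _ f])
    next
      case False
      define h where "h = inv\<^bsub>G\<^esub> (elt [x] [^]\<^bsub>G\<^esub> p)"
      have h: "h \<in> F" using power_in_F[OF l(2)] F_subgroup by (simp add: h_def subgroup.m_inv_closed)
      then have "h \<in> carrier G" by (rule F_closed)
      obtain f' where f': "f' \<in> F" "h \<otimes>\<^bsub>G\<^esub> elt w = elt w \<otimes>\<^bsub>G\<^esub> f'"
        using F_comm_word[OF h w(1)] by blast
      note c = c \<open>h \<in> carrier G\<close> F_closed[OF f'(1)]
      have "cls (l # u) = elt (replicate (p - 1) x) \<otimes>\<^bsub>G\<^esub> h \<otimes>\<^bsub>G\<^esub> (elt w \<otimes>\<^bsub>G\<^esub> f)"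
        using split False l inverse_letter by (simp add: h_def)
      also have "\<dots> = elt (replicate (p - 1) x) \<otimes>\<^bsub>G\<^esub> (h \<otimes>\<^bsub>G\<^esub> elt w) \<otimes>\<^bsub>G\<^esub> f"
        using c by (simp add: G.m_assoc)
      also have "\<dots> = elt (replicate (p - 1) x @ w) \<otimes>\<^bsub>G\<^esub> (f' \<otimes>\<^bsub>G\<^esub> f)"
        unfolding f'(2) elt_append[OF replicate_lists[OF l(2)] w(1)] using c by (simp add: G.m_assoc)
      finally show ?thesis
        using w l f' replicate_lists[OF l(2), of "p - 1"] subgroup.m_closed[OF F_subgroup f'(1) w(2)]
        by (intro bexI[of _ "replicate (p - 1) x @ w"] bexI[of _ "f' \<otimes>\<^bsub>G\<^esub> f"])
          (simp_all add: append_in_lists_conv del: in_lists_conv_set)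
    qed
  qed
  with u show ?thesis by blast
qed

section \<open>Residues modulo \<open>p\<close>\<close>

text \<open>Letters only permute coordinates and add constants, which respects congruence.\<close>

lemma word_act_mod:
  fixes m :: int
  assumes "\<And>y. v y mod m = v' y mod m"
  shows "word_act w v y mod m = word_act w v' y mod m"
proof (induction w arbitrary: y)
  case (Cons l w)
  show ?case
    using mod_add_cong[OF HOL.refl Cons] mod_diff_cong[OF Cons HOL.refl] by (simp add: letter_act_def)
qed (simp add: assms)

text \<open>Stated through a representative because the action is defined on words. Generators
  translate by \<open>p\<close> times a unit vector, and triviality modulo \<open>p\<close> passes
  to inverses and products.\<close>

lemma F_act:
  assumes "f \<in> F"
  shows "\<exists>w\<in>lists letters. f = cls w \<and> (\<forall>v y. word_act w v y mod int p = v y mod int p)"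
  using assms unfolding F_def
proof (induction rule: generate.induct)
  case one
  then show ?case by (intro bexI[of _ "[]"]) (auto simp: one_G)
next
  case (incl h)
  then obtain x where x: "x \<in> X" "h = elt (replicate p x)" by (auto simp: elt_replicate)
  then show ?case
    by (intro bexI[of _ "replicate p (x, True)"]) (auto simp: to_group_def pos_word_def word_act_power)
next
  case (inv h)
  then obtain x where x: "x \<in> X" "h = elt (replicate p x)" by (auto simp: elt_replicate)
  define u where "u = replicate p (x, True)"
  have u: "u \<in> lists letters" "h = cls u"
    using x by (auto simp: u_def to_group_def pos_word_def)
  have "h \<in> carrier G" using u unfolding carrier_G by blast
  then have "inv\<^bsub>G\<^esub> h \<in> carrier G" by simp
  then obtain w where w: "w \<in> lists letters" "inv\<^bsub>G\<^esub> h = cls w" unfolding carrier_G by blast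
  \<comment> \<open>Since \<open>u @ w\<close> represents the identity, applying \<open>w\<close>
    and then \<open>u\<close> returns \<open>v\<close>; as \<open>u\<close> is trivial modulo
    \<open>p\<close>, so is \<open>w\<close>.\<close>
  have "cls (u @ w) = cls []"
    using cls_mult[OF u(1) w(1)] u w \<open>h \<in> carrier G\<close> G.r_inv by (metis one_G)
  then have "u @ w \<approx> []"
    using u w word_class_eq_iff[of "u @ w"] by (simp add: append_in_lists_conv del: in_lists_conv_set)
  then have "word_act u (word_act w v) y = v y" for v y
    using word_act_cong[of "u @ w" "[]"] by simp
  moreover have "word_act u v' y mod int p = v' y mod int p" for v' y
    by (simp add: u_def word_act_power)
  ultimately have "word_act w v y mod int p = v y mod int p" for v y
    by metis
  then show ?case using w by blast
next
  case (eng h1 h2)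
  then obtain w1 w2 where w: "w1 \<in> lists letters" "h1 = cls w1" "w2 \<in> lists letters" "h2 = cls w2"
    and "\<forall>v y. word_act w1 v y mod int p = v y mod int p"
    and "\<forall>v y. word_act w2 v y mod int p = v y mod int p" by blast
  then show ?case
    using cls_mult[OF w(1,3)]
    by (intro bexI[of _ "w1 @ w2"]) (auto simp: append_in_lists_conv)
qed

text \<open>The orbit of 0 modulo \<open>p\<close>, the same for every representative by
  \<open>word_act_cong\<close>. Restriction to \<open>X\<close> makes it extensional, so its values
  lie in a finite set of size \<open>p ^ card X\<close>.\<close>

definition residue where
  "residue g = (\<lambda>y\<in>X. word_act (SOME w. w \<in> g) (\<lambda>_. 0) y mod int p)"

lemma residue_cls:
  assumes "w \<in> lists letters"
  shows "residue (cls w) = (\<lambda>y\<in>X. word_act w (\<lambda>_. 0) y mod int p)"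
proof -
  have "w \<in> cls w" using assms by (simp add: word_class_def word_cong.refl)
  then have "(SOME u. u \<in> cls w) \<in> cls w" by (rule someI)
  then have "w \<approx> (SOME u. u \<in> cls w)" by (simp add: word_class_def)
  then show ?thesis using word_act_cong by (simp add: residue_def)
qed

text \<open>The right factor acts first: it sends 0 to a vector divisible by \<open>p\<close>, and
  \<open>word_act_mod\<close> carries this congruence through the action of
  \<open>g\<close>.\<close>

lemma residue_mult_F:
  assumes "g \<in> carrier G" "f \<in> F"
  shows "residue (g \<otimes>\<^bsub>G\<^esub> f) = residue g"
proof -
  obtain u where u: "u \<in> lists letters" "g = cls u" using assms carrier_G by auto
  obtain w where w: "w \<in> lists letters" "f = cls w"
    "\<forall>v y. word_act w v y mod int p = v y mod int p" using F_act[OF assms(2)] by blast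
  have "word_act u (word_act w (\<lambda>_. 0)) y mod int p = word_act u (\<lambda>_. 0) y mod int p" for y
    using w(3) by (intro word_act_mod) blast
  then show ?thesis
    using u w(1) by (simp add: w(2) cls_mult residue_cls append_in_lists_conv del: in_lists_conv_set)
qed

text \<open>The last letter acts first, so appending \<open>y\<close> adds the unit vector at the
  image of \<open>y\<close> under the permutations of all letters of \<open>w\<close>. The right
  \<open>y\<close> is found by pulling \<open>z\<close> back through these letters.\<close>

lemma word_act_snoc:
  assumes "w \<in> lists X" "z \<in> X"
  shows "\<exists>y\<in>X. \<forall>u. word_act (pos_word (w @ [y])) (\<lambda>_. 0) u =
    of_bool (u = z) + word_act (pos_word w) (\<lambda>_. 0) u"
  using assms
proof (induction w arbitrary: z)
  case Nil
  then show ?case by (intro bexI[of _ z]) (simp_all add: pos_word_def letter_act_def)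
next
  case (Cons x w)
  have "linv x z \<in> X" using Cons.prems inv_lact_closed by blast
  then obtain y where y: "y \<in> X" "\<forall>u. word_act (pos_word (w @ [y])) (\<lambda>_. 0) u =
    of_bool (u = linv x z) + word_act (pos_word w) (\<lambda>_. 0) u" using Cons.IH by blast
  have "linv x u = linv x z \<longleftrightarrow> u = z" for u by (metis inv_lact(1))
  then show ?case
    using y by (intro bexI[of _ y]) (simp_all add: pos_word_Cons letter_act_def)
qed

text \<open>Induction on the coordinate sum: one positive coordinate is lowered by 1 and restored by
  \<open>word_act_snoc\<close>.\<close>

lemma word_act_surj:
  fixes v :: "'a \<Rightarrow> nat"
  assumes "\<And>y. y \<notin> X \<Longrightarrow> v y = 0"
  shows "\<exists>w\<in>lists X. \<forall>y. word_act (pos_word w) (\<lambda>_. 0) y = int (v y)"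
  using assms
proof (induction "\<Sum>y\<in>X. v y" arbitrary: v)
  case 0
  then have "v y = 0" for y using finite_X by (cases "y \<in> X") auto
  then show ?case by (intro bexI[of _ "[]"]) (auto simp: pos_word_def)
next
  case (Suc k)
  then obtain z where z: "z \<in> X" "v z > 0" by (metis gr0I nat.distinct(1) sum.neutral)
  define v' where "v' = v(z := v z - 1)"
  have "(\<Sum>y\<in>X. v y) = v z + (\<Sum>y\<in>X - {z}. v y)"
    using finite_X z by (simp add: sum.remove)
  moreover have "(\<Sum>y\<in>X. v' y) = (v z - 1) + (\<Sum>y\<in>X - {z}. v y)"
    using finite_X z by (simp add: sum.remove v'_def)
  ultimately have k: "k = (\<Sum>y\<in>X. v' y)" using Suc.hyps(2) z by simp
  have "v' y = 0" if "y \<notin> X" for y using Suc.prems that z by (auto simp: v'_def)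
  then obtain w where w: "w \<in> lists X" "\<forall>y. word_act (pos_word w) (\<lambda>_. 0) y = int (v' y)"
    using Suc.hyps(1)[OF k] by blast
  obtain y where "y \<in> X" "\<forall>u. word_act (pos_word (w @ [y])) (\<lambda>_. 0) u =
    of_bool (u = z) + word_act (pos_word w) (\<lambda>_. 0) u" using word_act_snoc[OF w(1) z(1)] by blast
  then show ?case using w z
    by (intro bexI[of _ "w @ [y]"]) (auto simp: v'_def)
qed

lemma residue_surj:
  assumes "v \<in> X \<rightarrow>\<^sub>E {0..<int p}"
  shows "\<exists>w\<in>lists X. residue (elt w) = v"
proof -
  \<comment> \<open>The value 0 off \<open>X\<close> meets the hypothesis of
    \<open>word_act_surj\<close>; the extensional \<open>v\<close> itself is
    \<open>undefined\<close> there.\<close>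
  obtain w where w: "w \<in> lists X"
    "\<forall>y. word_act (pos_word w) (\<lambda>_. 0) y = int (if y \<in> X then nat (v y) else 0)"
    using word_act_surj[of "\<lambda>y. if y \<in> X then nat (v y) else 0"] by auto
  have "v y = int (nat (v y)) mod int p" if "y \<in> X" for y
    using PiE_mem[OF assms that] by simp
  moreover have "v y = undefined" if "y \<notin> X" for y
    using assms that by (rule PiE_arb)
  ultimately have "residue (elt w) = v"
    using w pos_word_lists[OF w(1)] by (auto simp: to_group_def residue_cls simp del: in_lists_conv_set)
  then show ?thesis using w(1) by blast
qed

section \<open>Sorting words along an admissible enumeration\<close>

context
  fixes n :: nat and x :: "nat \<Rightarrow> 'a"
  assumes bij_x: "bij_betw x {1..n} X"
    and descent: "\<And>i j. 1 \<le> i \<Longrightarrow> i < j \<Longrightarrow> j \<le> n \<Longrightarrow>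
      \<exists>i' j'. i' \<in> {1..n} \<and> j' \<in> {1..n} \<and> i' < j \<and>
        ([x j, x i], [x i', x j']) \<in> quad_rels X r"
begin

lemma x_closed: "i \<in> {1..n} \<Longrightarrow> x i \<in> X"
  using bij_x by (rule bij_betw_apply)

lemma map_x_closed: "is \<in> lists {1..n} \<Longrightarrow> map x is \<in> lists X"
  using x_closed by auto

text \<open>Rewriting a descent \<open>x\<^sub>j x\<^sub>i\<close> to \<open>x\<^sub>i\<^sub>' x\<^sub>j\<^sub>'\<close> with \<open>i' < j\<close> decreases the word
  lexicographically, so the process ends with a sorted word.\<close>
lemma sort_word:
  assumes "is \<in> lists {1..n}"
  shows "\<exists>js\<in>lists {1..n}. sorted js \<and> elt (map x is) = elt (map x js)"
  using wf_lenlex[OF wf_less_than] assms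
proof (induction "is" rule: wf_induct_rule)
  case (less "is")
  show ?case
  proof (cases "sorted is")
    case False
    then obtain us j i vs where is_eq: "is = us @ j # i # vs" "i < j"
      using not_sorted_descent by blast
    have mem: "us \<in> lists {1..n}" "vs \<in> lists {1..n}" "i \<in> {1..n}" "j \<in> {1..n}"
      using less.prems is_eq by auto
    then obtain i' j' where ij': "i' \<in> {1..n}" "j' \<in> {1..n}" "i' < j"
      "([x j, x i], [x i', x j']) \<in> quad_rels X r"
      using descent[of i j] is_eq(2) by auto
    define is' where "is' = us @ i' # j' # vs"
    have is': "is' \<in> lists {1..n}" using mem ij' by (auto simp: is'_def)
    have "(is', is) \<in> lenlex less_than"
      using ij'(3) unfolding is'_def is_eq lenlex_conv
      by (simp add: lex_append_leftI)
    then obtain js where js: "js \<in> lists {1..n}" "sorted js" "elt (map x is') = elt (map x js)"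
      using less.IH is' by blast
    have "(pos_word [x j, x i], pos_word [x i', x j']) \<in> rels"
      using ij'(4) unfolding group_rels_def by blast
    then have cong: "pos_word [x j, x i] \<approx> pos_word [x i', x j']"
      using mem ij' x_closed by (intro word_cong.rel pos_word_lists) auto
    then have "elt [x j, x i] = elt [x i', x j']"
      using word_class_eq_iff[OF conjunct1[OF word_cong_lists[OF cong]]]
      by (simp only: to_group_def)
    moreover have elt3: "elt (map x us @ [x a, x b] @ map x vs) =
        elt (map x us) \<otimes>\<^bsub>G\<^esub> (elt [x a, x b] \<otimes>\<^bsub>G\<^esub> elt (map x vs))"
      if "a \<in> {1..n}" "b \<in> {1..n}" for a b
      using that mem x_closed map_x_closed
      by (simp only: elt_append append_in_lists_conv lists.intros)
    ultimately have "elt (map x is) = elt (map x is')"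
      using mem ij' by (simp add: is_eq is'_def)
    then show ?thesis using js by metis
  qed (use less.prems in blast)
qed

lemma word_eq_ordered:
  assumes "w \<in> lists X"
  shows "\<exists>\<alpha>. elt w = elt (ordered_word n x \<alpha>)"
proof -
  have "\<exists>is\<in>lists {1..n}. w = map x is"
    using assms bij_x by (metis bij_betw_imp_surj_on lists_image imageE)
  then show ?thesis
    using sort_word sorted_eq_ordered_word by metis
qed

text \<open>An arbitrary index list lets the induction peel off one block. It splits into its part
  modulo \<open>p\<close> and a power \<open>h\<close> in \<open>F\<close>, which
  \<open>F_comm_word\<close> moves past the later blocks.\<close>

lemma reduce_exponents:
  assumes "is \<in> lists {1..n}"
  shows "\<exists>f\<in>F. elt (concat (map (\<lambda>i. replicate (\<alpha> i) (x i)) is)) =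
    elt (concat (map (\<lambda>i. replicate (\<alpha> i mod p) (x i)) is)) \<otimes>\<^bsub>G\<^esub> f"
  using assms
proof (induction "is")
  case Nil
  then show ?case
    by (intro bexI[of _ "\<one>\<^bsub>G\<^esub>"]) (simp_all add: elt_Nil subgroup.one_closed[OF F_subgroup])
next
  case (Cons i "is")
  define u where "u \<beta> = concat (map (\<lambda>i. replicate (\<beta> i) (x i)) is)" for \<beta>
  have u: "u \<beta> \<in> lists X" for \<beta>
    using Cons.hyps x_closed by (auto simp: u_def)
  have i: "x i \<in> X" using Cons.hyps x_closed by blast
  obtain f where f: "f \<in> F" "elt (u \<alpha>) = elt (u (\<lambda>i. \<alpha> i mod p)) \<otimes>\<^bsub>G\<^esub> f"
    using Cons.IH unfolding u_def by blast
  define a b h where "a = elt (replicate (\<alpha> i mod p) (x i))"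
    and "b = elt (u (\<lambda>i. \<alpha> i mod p))" and "h = elt [x i] [^]\<^bsub>G\<^esub> (p * (\<alpha> i div p))"
  have h: "h \<in> F" unfolding h_def using i by (rule power_pow_in_F)
  obtain f' where f': "f' \<in> F" "h \<otimes>\<^bsub>G\<^esub> b = b \<otimes>\<^bsub>G\<^esub> f'"
    using F_comm_word[OF h u] unfolding b_def by blast
  have c: "a \<in> carrier G" "b \<in> carrier G" "h \<in> carrier G" "f \<in> carrier G" "f' \<in> carrier G"
    using u replicate_lists[OF i] h f(1) f'(1) F_closed by (simp_all add: a_def b_def del: in_lists_conv_set)
  have "elt (replicate (\<alpha> i) (x i)) = a \<otimes>\<^bsub>G\<^esub> h"
    using i by (simp add: a_def h_def elt_replicate G.nat_pow_mult)
  then have "elt (replicate (\<alpha> i) (x i) @ u \<alpha>) = a \<otimes>\<^bsub>G\<^esub> h \<otimes>\<^bsub>G\<^esub> (b \<otimes>\<^bsub>G\<^esub> f)"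
    using elt_append[OF replicate_lists[OF i] u] f(2) by (simp add: b_def)
  also have "\<dots> = a \<otimes>\<^bsub>G\<^esub> (h \<otimes>\<^bsub>G\<^esub> b) \<otimes>\<^bsub>G\<^esub> f"
    using c by (simp add: G.m_assoc)
  also have "\<dots> = a \<otimes>\<^bsub>G\<^esub> b \<otimes>\<^bsub>G\<^esub> (f' \<otimes>\<^bsub>G\<^esub> f)"
    unfolding f'(2) using c by (simp add: G.m_assoc)
  also have "a \<otimes>\<^bsub>G\<^esub> b = elt (replicate (\<alpha> i mod p) (x i) @ u (\<lambda>i. \<alpha> i mod p))"
    unfolding a_def b_def using elt_append[OF replicate_lists[OF i] u] by simp
  finally show ?case
    using subgroup.m_closed[OF F_subgroup f'(1) f(1)] by (auto simp: u_def)
qed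

section \<open>\<open>Y\<close> as a system of representatives for the left cosets of
  \<open>F\<close>\<close>

definition Y where
  "Y = {elt (ordered_word n x \<alpha>) | \<alpha>. \<forall>i\<in>{1..n}. \<alpha> i \<le> p - 1}"

lemma ordered_word_lists: "ordered_word n x \<alpha> \<in> lists X"
  using x_closed by (auto simp: ordered_word_def)

lemma Y_closed: "y \<in> Y \<Longrightarrow> y \<in> carrier G"
  unfolding Y_def using ordered_word_lists by auto

lemma Y_F_decomp:
  assumes "g \<in> carrier G"
  shows "\<exists>y\<in>Y. \<exists>f\<in>F. g = y \<otimes>\<^bsub>G\<^esub> f"
proof -
  obtain w f where w: "w \<in> lists X" "f \<in> F" "g = elt w \<otimes>\<^bsub>G\<^esub> f"
    using carrier_decomp[OF assms] by blast
  obtain \<alpha> where \<alpha>: "elt w = elt (ordered_word n x \<alpha>)" using word_eq_ordered[OF w(1)] by blast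
  define y where "y = elt (ordered_word n x (\<lambda>i. \<alpha> i mod p))"
  have "[1..<n + 1] \<in> lists {1..n}" by auto
  then obtain h where h: "h \<in> F" "elt w = y \<otimes>\<^bsub>G\<^esub> h"
    using reduce_exponents[of "[1..<n + 1]" \<alpha>] unfolding \<alpha> y_def ordered_word_def by blast
  have "\<alpha> i mod p \<le> p - 1" for i
    using mod_less_divisor[OF p_pos, of "\<alpha> i"] by linarith
  then have y: "y \<in> Y" unfolding Y_def y_def by blast
  have "g = y \<otimes>\<^bsub>G\<^esub> (h \<otimes>\<^bsub>G\<^esub> f)"
    using w(2,3) h y Y_closed F_closed by (simp add: G.m_assoc)
  then show ?thesis using y subgroup.m_closed[OF F_subgroup h(1) w(2)] by blast
qed

text \<open>Only an upper bound at this point: distinct exponents are not yet known to give distinct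
  elements of \<open>G\<close>.\<close>

lemma finite_card_Y: "finite Y" "card Y \<le> p ^ n"
proof -
  let ?A = "{1..n} \<rightarrow>\<^sub>E {0..<p}"
  have "y \<in> (\<lambda>\<alpha>. elt (ordered_word n x \<alpha>)) ` ?A" if "y \<in> Y" for y
  proof -
    obtain \<alpha> where \<alpha>: "y = elt (ordered_word n x \<alpha>)" "\<forall>i\<in>{1..n}. \<alpha> i \<le> p - 1"
      using \<open>y \<in> Y\<close> unfolding Y_def by blast
    \<comment> \<open>Exponents outside \<open>{1..n}\<close> do not affect the word, so they can be
      normalised to land in the finite set \<open>?A\<close>.\<close>
    have "ordered_word n x \<alpha> = ordered_word n x (restrict \<alpha> {1..n})"
      by (auto simp: ordered_word_def intro!: arg_cong[of _ _ concat])
    moreover have "restrict \<alpha> {1..n} \<in> ?A"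
      using \<alpha>(2) p_pos by (force simp: Suc_le_eq)
    ultimately show ?thesis using \<alpha>(1) by auto
  qed
  then have sub: "Y \<subseteq> (\<lambda>\<alpha>. elt (ordered_word n x \<alpha>)) ` ?A" by blast
  have fin: "finite ?A" by (intro finite_PiE) auto
  show "finite Y" using sub fin by (meson finite_imageI finite_subset)
  have "card Y \<le> card ?A" using sub fin by (rule surj_card_le[rotated])
  then show "card Y \<le> p ^ n" by (simp add: card_PiE)
qed

text \<open>Every residue function comes from a word, hence from an element of \<open>Y\<close> by
  decomposition and coset invariance. So \<open>Y\<close> has at least \<open>p ^ n\<close> residues
  but at most \<open>p ^ n\<close> elements, which forces equality and injectivity.\<close>

lemma residue_inj_Y: "inj_on residue Y" and card_Y: "card Y = p ^ n"
proof -
  let ?R = "X \<rightarrow>\<^sub>E {0..<int p}"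
  have "v \<in> residue ` Y" if v: "v \<in> ?R" for v
  proof -
    obtain w where w: "w \<in> lists X" "residue (elt w) = v" using residue_surj[OF v] by blast
    obtain y f where "y \<in> Y" "f \<in> F" "elt w = y \<otimes>\<^bsub>G\<^esub> f"
      using Y_F_decomp[OF elt_closed[OF w(1)]] by blast
    then show ?thesis using residue_mult_F[OF Y_closed] w(2) by force
  qed
  then have "card ?R \<le> card (residue ` Y)"
    using finite_card_Y(1) by (intro card_mono) auto
  moreover have "card X = n" using bij_betw_same_card[OF bij_x] by simp
  ultimately have le: "p ^ n \<le> card (residue ` Y)"
    using finite_X by (simp add: card_PiE)
  moreover have "card (residue ` Y) \<le> card Y"
    using finite_card_Y(1) by (rule card_image_le)
  ultimately show "card Y = p ^ n" using finite_card_Y(2) by linarith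
  with le \<open>card (residue ` Y) \<le> card Y\<close> show "inj_on residue Y"
    using finite_card_Y(1) by (intro eq_card_imp_inj_on) auto
qed

text \<open>The two sides have the residues of \<open>y\<close> and \<open>t\<close>, so injectivity
  on \<open>Y\<close> gives \<open>y = t\<close>; cancellation in \<open>G\<close> does the
  rest.\<close>

lemma Y_F_unique:
  assumes "y \<in> Y" "f \<in> F" "t \<in> Y" "h \<in> F" "y \<otimes>\<^bsub>G\<^esub> f = t \<otimes>\<^bsub>G\<^esub> h"
  shows "y = t \<and> f = h"
proof -
  have "residue y = residue t"
    using assms residue_mult_F Y_closed by metis
  then have "y = t" using residue_inj_Y assms by (auto dest: inj_onD)
  then show ?thesis using assms Y_closed F_closed by simp
qed

lemma Y_F_ex1:
  assumes "g \<in> carrier G"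
  shows "\<exists>!yW. yW \<in> Y \<times> F \<and> g = fst yW \<otimes>\<^bsub>G\<^esub> snd yW"
proof -
  obtain y f where yf: "y \<in> Y" "f \<in> F" "g = y \<otimes>\<^bsub>G\<^esub> f" using Y_F_decomp[OF assms] by blast
  show ?thesis
  proof (rule ex1I[of _ "(y, f)"])
    fix yW assume "yW \<in> Y \<times> F \<and> g = fst yW \<otimes>\<^bsub>G\<^esub> snd yW"
    then have "fst yW \<in> Y" "snd yW \<in> F" "fst yW \<otimes>\<^bsub>G\<^esub> snd yW = y \<otimes>\<^bsub>G\<^esub> f"
      by (auto simp flip: yf(3))
    then have "fst yW = y \<and> snd yW = f" using yf(1,2) by (intro Y_F_unique)
    then show "yW = (y, f)" by (simp add: prod_eq_iff)
  qed (use yf in simp)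
qed

lemma coset_disjoint:
  assumes "y \<in> Y" "t \<in> Y" "y \<noteq> t"
  shows "(y <#\<^bsub>G\<^esub> F) \<inter> (t <#\<^bsub>G\<^esub> F) = {}"
  using Y_F_unique assms unfolding l_coset_def by blast

lemma carrier_coset_union: "carrier G = (\<Union>y\<in>Y. y <#\<^bsub>G\<^esub> F)"
proof
  show "carrier G \<subseteq> (\<Union>y\<in>Y. y <#\<^bsub>G\<^esub> F)"
    using Y_F_decomp unfolding l_coset_def by blast
  show "(\<Union>y\<in>Y. y <#\<^bsub>G\<^esub> F) \<subseteq> carrier G"
    using Y_closed F_closed unfolding l_coset_def by auto
qed

text \<open>The cosets are nonempty, so disjointness makes them distinct and they are as many as the
  elements of \<open>Y\<close>.\<close>

lemma card_cosets: "card ((\<lambda>y. y <#\<^bsub>G\<^esub> F) ` Y) = p ^ n"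
proof -
  have "y <#\<^bsub>G\<^esub> F \<noteq> {}" for y
    using subgroup.one_closed[OF F_subgroup] unfolding l_coset_def by blast
  then have "inj_on (\<lambda>y. y <#\<^bsub>G\<^esub> F) Y"
    using coset_disjoint by (intro inj_onI) blast
  then show ?thesis by (simp add: card_image card_Y)
qed

end

end

theorem theoremA:
  fixes X :: "'a set" and r :: "'a \<times> 'a \<Rightarrow> 'a \<times> 'a"
    and n p :: nat and x :: "nat \<Rightarrow> 'a"
    and G :: "('a \<times> bool) list set monoid"
    and Y F :: "('a \<times> bool) list set set"
  assumes "finite X" and "card X = n"
    and "solution X r" and "square_free X r"
    and "p = cyclic_degree X r"
    and "admissible TYPE('k::field) X r n x"
    and "G = assoc_group X r"
    and "Y = {to_group X r (ordered_word n x \<alpha>) | \<alpha>. \<forall>i\<in>{1..n}. \<alpha> i \<le> p - 1}"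
    and "F = generate G {to_group X r [x i] [^]\<^bsub>G\<^esub> p | i. i \<in> {1..n}}"
  shows "(\<forall>u\<in>carrier G. \<exists>!yW. yW \<in> Y \<times> F \<and> u = fst yW \<otimes>\<^bsub>G\<^esub> snd yW) \<and>
    (\<forall>y\<in>Y. \<forall>z\<in>Y. \<exists>!tW. tW \<in> Y \<times> F \<and> y \<otimes>\<^bsub>G\<^esub> z = fst tW \<otimes>\<^bsub>G\<^esub> snd tW) \<and>
    (carrier G = (\<Union>y\<in>Y. y <#\<^bsub>G\<^esub> F) \<and>
     (\<forall>y\<in>Y. \<forall>t\<in>Y. y \<noteq> t \<longrightarrow> (y <#\<^bsub>G\<^esub> F) \<inter> (t <#\<^bsub>G\<^esub> F) = {}) \<and>
     card ((\<lambda>y. y <#\<^bsub>G\<^esub> F) ` Y) = p ^ n)"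
proof -
  interpret S: square_free_solution X r
    using assms by unfold_locales
  have bij: "bij_betw x {1..n} X"
    using assms(6) unfolding admissible_def by blast
  \<comment> \<open>These two facts discharge the assumptions of the context on
    enumerations.\<close>
  note enum = bij admissible_descent[OF assms(6)]
  have p: "p = S.p" by (simp add: assms(5) S.p_def)
  have G: "G = assoc_group X r" by fact
  have Y: "Y = S.Y n x"
    using assms(8) S.Y_def[OF enum] by (simp add: p)
  \<comment> \<open>The enumeration is onto \<open>X\<close>, so indexing the generators by
    \<open>i\<close> or by letters gives the same set.\<close>
  have "{to_group X r [x i] [^]\<^bsub>G\<^esub> p | i. i \<in> {1..n}} = {to_group X r [z] [^]\<^bsub>G\<^esub> p | z. z \<in> X}"
    using bij_betw_imp_surj_on[OF bij] by blast
  then have F: "F = S.F"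
    using assms(9) by (simp add: S.F_def p G)
  \<comment> \<open>With this, the second claim is the first one at the product of \<open>y\<close>
    and \<open>z\<close>.\<close>
  have "y \<otimes>\<^bsub>assoc_group X r\<^esub> z \<in> carrier (assoc_group X r)" if "y \<in> S.Y n x" "z \<in> S.Y n x" for y z
    using that S.Y_closed[OF enum] by simp
  then show ?thesis
    unfolding p G Y F
    using S.Y_F_ex1[OF enum] S.coset_disjoint[OF enum] S.carrier_coset_union[OF enum]
      S.card_cosets[OF enum] by simp
qed

end
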